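(* Let $l$ be a fixed positive integer. Any monotone, exact linear, $l$-regular CNF formula $F$ is either x-unsat, or its x-satisfiability is decidable in time $O\left(\exp\left(f(l)\,\ln(n)\,\sqrt{n}\right)\right)$ or better, for fixed $l$ and up to polynomial corrections, where $n = |V(F)|$ and $f(l)$ is a real number depending only on $l$.
   Context: A CNF formula $F$ is a non-empty conjunction of non-empty clauses, each clause being a disjunction of literals; a literal is an occurrence of a Boolean variable or of its negation. $F$ is monotone if it contains positive (unnegated) literals only. $V(C)$ denotes the set of variables occurring in the clause $C$, and $V(F)$ the set of variables occurring in $F$. $F$ is exact linear if any two distinct clauses of $F$ have exactly one variable in common. $F$ is $l$-regular if every variable of $F$ occurs exactly $l$ times in $F$. $F$ is x-sat if there is a truth assignment to $V(F)$ that makes exactly one literal in each clause of $F$ true; otherwise $F$ is x-unsat. Deciding the x-satisfiability of $F$ means deciding whether $F$ is x-sat. "Up to polynomial corrections" means that factors polynomial in the size of the formula are disregarded in the running time. *)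

theory Defs
  imports Complex_Main "HOL-Computational_Algebra.Polynomial"
begin

section \<open>CNF formulas and exact satisfiability\<close>

datatype lit = Pos nat | Neg nat

primrec var_of :: "lit \<Rightarrow> nat" where
  "var_of (Pos x) = x"
| "var_of (Neg x) = x"

primrec lit_true :: "(nat \<Rightarrow> bool) \<Rightarrow> lit \<Rightarrow> bool" where
  "lit_true \<alpha> (Pos x) \<longleftrightarrow> \<alpha> x"
| "lit_true \<alpha> (Neg x) \<longleftrightarrow> \<not> \<alpha> x"

text \<open>Clauses are sets of literals and formulas are sets of clauses, as is usual for linear formulas:
  neither a literal within a clause nor a clause within a formula is repeated.\<close>

type_synonym clause = "lit set"
type_synonym formula = "clause set"

definition is_cnf :: "formula \<Rightarrow> bool" where
  "is_cnf F \<longleftrightarrow> finite F \<and> F \<noteq> {} \<and> (\<forall>C\<in>F. finite C \<and> C \<noteq> {})"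

definition clause_vars :: "clause \<Rightarrow> nat set" where
  "clause_vars C = var_of ` C"

definition formula_vars :: "formula \<Rightarrow> nat set" where
  "formula_vars F = (\<Union>C\<in>F. clause_vars C)"

definition monotone_cnf :: "formula \<Rightarrow> bool" where
  "monotone_cnf F \<longleftrightarrow> (\<forall>C\<in>F. \<forall>L\<in>C. \<exists>x. L = Pos x)"

definition exact_linear :: "formula \<Rightarrow> bool" where
  "exact_linear F \<longleftrightarrow>
     (\<forall>C\<in>F. \<forall>D\<in>F. C \<noteq> D \<longrightarrow> card (clause_vars C \<inter> clause_vars D) = 1)"

definition occurrences :: "formula \<Rightarrow> nat \<Rightarrow> nat" where
  "occurrences F x = card {(C, L). C \<in> F \<and> L \<in> C \<and> var_of L = x}"

definition regular_cnf :: "nat \<Rightarrow> formula \<Rightarrow> bool" where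
  "regular_cnf l F \<longleftrightarrow> (\<forall>x\<in>formula_vars F. occurrences F x = l)"

text \<open>Assignments are total; the values outside \<open>formula_vars F\<close> are irrelevant.\<close>

definition x_sat :: "formula \<Rightarrow> bool" where
  "x_sat F \<longleftrightarrow> (\<exists>\<alpha>. \<forall>C\<in>F. card {L\<in>C. lit_true \<alpha> L} = 1)"

definition formula_size :: "formula \<Rightarrow> nat" where
  "formula_size F = (\<Sum>C\<in>F. card C)"

section \<open>Random access machines\<close>

text \<open>Structured programs for a RAM with a register file and an indirectly addressed memory, with
  unit cost. The only arithmetic is addition and truncated subtraction, so a value grows by at most
  one bit per step and unit-cost time is polynomially related to Turing machine time.\<close>

type_synonym state = "(nat \<Rightarrow> nat) \<times> (nat \<Rightarrow> nat)"

datatype com =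
    SetConst nat nat
  | Copy nat nat
  | Add nat nat nat
  | Sub nat nat nat
  | Load nat nat
  | Store nat nat
  | Seq com com
  | IfNonzero nat com com
  | WhileNonzero nat com

text \<open>\<open>exec c s t s'\<close>: started in \<open>s\<close>, program \<open>c\<close> halts after exactly \<open>t\<close> steps in \<open>s'\<close>.\<close>

inductive exec :: "com \<Rightarrow> state \<Rightarrow> nat \<Rightarrow> state \<Rightarrow> bool" where
  SetConst: "exec (SetConst i k) (r, m) 1 (r(i := k), m)"
| Copy: "exec (Copy i j) (r, m) 1 (r(i := r j), m)"
| Add: "exec (Add i j k) (r, m) 1 (r(i := r j + r k), m)"
| Sub: "exec (Sub i j k) (r, m) 1 (r(i := r j - r k), m)"
| Load: "exec (Load i j) (r, m) 1 (r(i := m (r j)), m)"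
| Store: "exec (Store i j) (r, m) 1 (r, m(r i := r j))"
| Seq: "exec c\<^sub>1 s t\<^sub>1 s' \<Longrightarrow> exec c\<^sub>2 s' t\<^sub>2 s'' \<Longrightarrow> exec (Seq c\<^sub>1 c\<^sub>2) s (t\<^sub>1 + t\<^sub>2) s''"
| IfTrue: "fst s i \<noteq> 0 \<Longrightarrow> exec c\<^sub>1 s t s' \<Longrightarrow> exec (IfNonzero i c\<^sub>1 c\<^sub>2) s (Suc t) s'"
| IfFalse: "fst s i = 0 \<Longrightarrow> exec c\<^sub>2 s t s' \<Longrightarrow> exec (IfNonzero i c\<^sub>1 c\<^sub>2) s (Suc t) s'"
| WhileFalse: "fst s i = 0 \<Longrightarrow> exec (WhileNonzero i c) s 1 s"
| WhileTrue: "fst s i \<noteq> 0 \<Longrightarrow> exec c s t\<^sub>1 s' \<Longrightarrow> exec (WhileNonzero i c) s' t\<^sub>2 s''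
    \<Longrightarrow> exec (WhileNonzero i c) s (Suc (t\<^sub>1 + t\<^sub>2)) s''"

inductive_cases SetConstE: "exec (SetConst i k) s t s'"
inductive_cases CopyE: "exec (Copy i j) s t s'"
inductive_cases AddE: "exec (Add i j k) s t s'"
inductive_cases SubE: "exec (Sub i j k) s t s'"
inductive_cases LoadE: "exec (Load i j) s t s'"
inductive_cases StoreE: "exec (Store i j) s t s'"
inductive_cases SeqE: "exec (Seq c d) s t s'"
inductive_cases IfE: "exec (IfNonzero i c d) s t s'"
inductive_cases WhileE: "exec (WhileNonzero i c) s t s'"

lemma exec_deterministic:
  "exec c s t s' \<Longrightarrow> exec c s u s'' \<Longrightarrow> u = t \<and> s'' = s'"
proof (induction arbitrary: u s'' rule: exec.induct)
  case (Seq c\<^sub>1 s t\<^sub>1 s1 c\<^sub>2 t\<^sub>2 s2)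
  from Seq.prems obtain u\<^sub>1 u\<^sub>2 z where "u = u\<^sub>1 + u\<^sub>2" "exec c\<^sub>1 s u\<^sub>1 z" "exec c\<^sub>2 z u\<^sub>2 s''"
    by (rule SeqE)
  with Seq.IH show ?case by metis
next
  case (IfTrue s i c\<^sub>1 t s' c\<^sub>2)
  from IfTrue.prems obtain u' where "u = Suc u'" "exec c\<^sub>1 s u' s''"
    by (rule IfE; use IfTrue.hyps in simp)
  with IfTrue.IH show ?case by metis
next
  case (IfFalse s i c\<^sub>2 t s' c\<^sub>1)
  from IfFalse.prems obtain u' where "u = Suc u'" "exec c\<^sub>2 s u' s''"
    by (rule IfE; use IfFalse.hyps in simp)
  with IfFalse.IH show ?case by metis
next
  case (WhileFalse s i c)
  from WhileFalse.prems show ?case by (rule WhileE; use WhileFalse.hyps in simp)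
next
  case (WhileTrue s i c t\<^sub>1 s1 t\<^sub>2 s2)
  from WhileTrue.prems obtain u\<^sub>1 u\<^sub>2 z where "u = Suc (u\<^sub>1 + u\<^sub>2)" "exec c s u\<^sub>1 z"
    "exec (WhileNonzero i c) z u\<^sub>2 s''"
    by (rule WhileE; use WhileTrue.hyps in simp)
  with WhileTrue.IH show ?case by metis
qed (auto elim: SetConstE CopyE AddE SubE LoadE StoreE)

section \<open>Deciding x-satisfiability\<close>

definition lists_formula :: "lit list list \<Rightarrow> formula \<Rightarrow> bool" where
  "lists_formula Cs F \<longleftrightarrow>
     distinct (map set Cs) \<and> (\<forall>C\<in>set Cs. distinct C) \<and> set (map set Cs) = F"

primrec encode_lit :: "lit \<Rightarrow> nat list" where
  "encode_lit (Pos x) = [1, x]"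
| "encode_lit (Neg x) = [0, x]"

definition encode_clause :: "lit list \<Rightarrow> nat list" where
  "encode_clause C = length C # concat (map encode_lit C)"

definition encode_formula :: "lit list list \<Rightarrow> nat list" where
  "encode_formula Cs = length Cs # concat (map encode_clause Cs)"

definition initial_state :: "nat list \<Rightarrow> state" where
  "initial_state w = (\<lambda>_. 0, \<lambda>a. if a < length w then w ! a else 0)"

text \<open>The bound must be met whichever order the clauses and literals are presented in; the verdict
  is left in register 0.\<close>

definition decides_x_sat_within :: "com \<Rightarrow> formula \<Rightarrow> real \<Rightarrow> bool" where
  "decides_x_sat_within c F B \<longleftrightarrow>
     (\<forall>Cs. lists_formula Cs F \<longrightarrow>
       (\<exists>t s. exec c (initial_state (encode_formula Cs)) t s \<and>
              fst s 0 = (if x_sat F then 1 else 0) \<and> real t \<le> B))"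

end

theory Submission
  imports Defs
begin

text \<open>Let \<open>m\<close> be the number of clauses. In an exact solution every clause has a unique true
  variable, so at most \<open>m\<close> variables are true, and exhaustive search over the sets of at most \<open>m\<close>
  variables takes time \<open>N ^ O(m)\<close>, where \<open>N\<close> is the length of the input. If the formula
  is exact linear and \<open>l\<close>-regular, a clause \<open>C\<close> meets every clause, hence \<open>m \<le> l \<cdot> |C|\<close>; summing
  over \<open>C\<close> and counting literals gives \<open>m\<^sup>2 \<le> l\<^sup>2 \<cdot> n\<close>. So \<open>m \<le> l \<cdot> sqrt n\<close>,
  and the search has the required running time.

  The program represents a set of variables by a number \<open>v\<close> between \<open>1\<close> and \<open>N\<^sup>m\<close>: its base \<open>N\<close> digits
  are positions in the input, and the set consists of the contents of these positions. The spare time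
  allows \<open>v\<close> to be decoded with division by repeated subtraction.\<close>

section \<open>Weakest preconditions with running time\<close>

text \<open>Total correctness: termination is part of the claim. The postcondition also receives the
  step count, so one symbolic execution yields both result and running time.\<close>

definition wp :: "com \<Rightarrow> (nat \<Rightarrow> state \<Rightarrow> bool) \<Rightarrow> state \<Rightarrow> bool" where
  "wp c Q s \<longleftrightarrow> (\<exists>t s'. exec c s t s' \<and> Q t s')"

lemma wp_mono: "wp c Q s \<Longrightarrow> (\<And>t s'. Q t s' \<Longrightarrow> Q' t s') \<Longrightarrow> wp c Q' s"
  unfolding wp_def by blast

text \<open>Runs are deterministic, so a single known run settles both directions.\<close>

lemma wp_exec: "exec c s t s' \<Longrightarrow> wp c Q s \<longleftrightarrow> Q t s'"
  unfolding wp_def using exec_deterministic by blast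

lemma wp_atomic [simp]:
  "wp (SetConst i k) Q (r, m) \<longleftrightarrow> Q 1 (r(i := k), m)"
  "wp (Copy i j) Q (r, m) \<longleftrightarrow> Q 1 (r(i := r j), m)"
  "wp (Add i j k) Q (r, m) \<longleftrightarrow> Q 1 (r(i := r j + r k), m)"
  "wp (Sub i j k) Q (r, m) \<longleftrightarrow> Q 1 (r(i := r j - r k), m)"
  "wp (Load i j) Q (r, m) \<longleftrightarrow> Q 1 (r(i := m (r j)), m)"
  "wp (Store i j) Q (r, m) \<longleftrightarrow> Q 1 (r, m(r i := r j))"
  by (rule wp_exec, rule exec.intros)+

lemma wp_Seq [simp]: "wp (Seq c d) Q s \<longleftrightarrow> wp c (\<lambda>t. wp d (\<lambda>u. Q (t + u))) s"
  unfolding wp_def by (blast elim: SeqE intro: exec.Seq)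

lemma exec_If_iff:
  "exec (IfNonzero i c d) s t s' \<longleftrightarrow>
     (\<exists>u. t = Suc u \<and> exec (if fst s i \<noteq> 0 then c else d) s u s')"
  by (cases "fst s i = 0") (auto elim: IfE intro: exec.IfTrue exec.IfFalse)

lemma wp_If [simp]:
  "wp (IfNonzero i c d) Q s \<longleftrightarrow>
     (if fst s i \<noteq> 0 then wp c (\<lambda>t. Q (Suc t)) s else wp d (\<lambda>t. Q (Suc t)) s)"
  unfolding wp_def exec_If_iff by auto

lemma exec_While_iff:
  assumes "fst s i \<noteq> 0"
  shows "exec (WhileNonzero i c) s t s' \<longleftrightarrow>
    (\<exists>t\<^sub>1 s1 t\<^sub>2. t = Suc (t\<^sub>1 + t\<^sub>2) \<and> exec c s t\<^sub>1 s1 \<and> exec (WhileNonzero i c) s1 t\<^sub>2 s')"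
    (is "?L \<longleftrightarrow> ?R")
proof
  show "?L \<Longrightarrow> ?R" by (erule WhileE) (use assms in blast)+
  show "?R \<Longrightarrow> ?L" using assms by (blast intro: exec.WhileTrue)
qed

text \<open>The right-hand side contains the loop again; the rule is therefore applied once per
  induction step instead of being a simplification rule.\<close>

lemma wp_While:
  "wp (WhileNonzero i c) Q s \<longleftrightarrow>
     (if fst s i \<noteq> 0 then wp c (\<lambda>t. wp (WhileNonzero i c) (\<lambda>u. Q (Suc (t + u)))) s else Q 1 s)"
proof (cases "fst s i = 0")
  case True
  then show ?thesis by (simp add: wp_exec[OF exec.WhileFalse])
next
  case False
  then show ?thesis
    unfolding wp_def exec_While_iff[OF False] by (simp del: split_paired_Ex) blast
qed

section \<open>Memory segments\<close>

definition holds :: "(nat \<Rightarrow> nat) \<Rightarrow> nat \<Rightarrow> nat list \<Rightarrow> bool" where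
  "holds m a xs \<longleftrightarrow> (\<forall>i<length xs. m (a + i) = xs ! i)"

lemma holds_Nil [simp]: "holds m a []"
  by (simp add: holds_def)

lemma holds_Cons [simp]: "holds m a (x # xs) \<longleftrightarrow> m a = x \<and> holds m (a + 1) xs"
  unfolding holds_def by (auto simp: less_Suc_eq_0_disj)

lemma holds_append [simp]:
  "holds m a (xs @ ys) \<longleftrightarrow> holds m a xs \<and> holds m (a + length xs) ys"
  by (induction xs arbitrary: a) auto

lemma length_encode_lits [simp]: "length (concat (map encode_lit C)) = 2 * length C"
proof (induction C)
  case (Cons L C)
  then show ?case by (cases L) auto
qed simp

section \<open>The program\<close>

text \<open>With this rule the simplifier would turn register \<open>1\<close> into \<open>Suc 0\<close>, and an unrolled loop
  would no longer match its definition.\<close>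

declare One_nat_def [simp del]

notation Seq (infixr ";;" 60)

section \<open>Finding the input length\<close>

text \<open>Register 0 holds the verdict, 1 the input length \<open>N\<close>, 2 the number of clauses, 3 the current
  candidate \<open>v\<close> and 9 the constant one; the others are temporary.\<close>

definition parse_loop :: com where
  "parse_loop = WhileNonzero 5 (Load 6 1 ;; Add 1 1 6 ;; Add 1 1 6 ;; Add 1 1 9 ;; Sub 5 5 9)"

text \<open>Register 1 jumps from one clause header to the next, a clause of \<open>k\<close>
  literals taking \<open>1 + 2 * k\<close> cells. Started at address 1, behind the clause count, it
  stops at the end of the input.\<close>

lemma parse_loop:
  assumes "holds m (r 1) (concat (map encode_clause Cs))" "r 5 = length Cs" "r 9 = 1"
  shows "wp parse_loop (\<lambda>t (r', m'). t \<le> 6 * length Cs + 1 \<and> m' = m \<and>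
      r' 1 = r 1 + length (concat (map encode_clause Cs)) \<and>
      (\<forall>i. i \<noteq> 1 \<and> i \<noteq> 5 \<and> i \<noteq> 6 \<longrightarrow> r' i = r i)) (r, m)"
  using assms
proof (induction Cs arbitrary: r)
  case Nil
  then show ?case unfolding parse_loop_def by (subst wp_While) simp
next
  case (Cons C Cs)
  let ?Q = "\<lambda>q t (r', m'). t \<le> 6 * length Cs + 1 \<and> m' = m \<and>
      r' 1 = q 1 + length (concat (map encode_clause Cs)) \<and>
      (\<forall>i. i \<noteq> 1 \<and> i \<noteq> 5 \<and> i \<noteq> 6 \<longrightarrow> r' i = q i)"
  \<comment> \<open>Describing \<open>q\<close> by equations lets the hypothesis match whatever
    updated register file the loop body leaves behind.\<close>
  have IH: "wp parse_loop (?Q q) (q, m)"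
    if "q 1 = r 1 + 1 + 2 * length C" "q 5 = length Cs" "q 9 = 1" for q
    using that Cons.prems by (intro Cons.IH) (auto simp: encode_clause_def)
  show ?case
    using Cons.prems
    \<comment> \<open>One unrolling; \<open>fold\<close> hides the remaining loop behind its name,
      so that \<open>IH\<close> applies. The later loops follow the same pattern.\<close>
    apply (subst parse_loop_def, subst wp_While, fold parse_loop_def)
    apply (simp add: encode_clause_def)
    apply (rule wp_mono[OF IH])
    apply (auto simp: encode_clause_def)
    done
qed

section \<open>Multiplication, powers and division\<close>

definition mult_loop :: com where
  "mult_loop = WhileNonzero 7 (Add 6 6 3 ;; Sub 7 7 9)"

lemma mult_loop:
  assumes "r 7 = k" "r 9 = 1"
  shows "wp mult_loop (\<lambda>t (r', m'). t \<le> 3 * k + 1 \<and> m' = m \<and>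
      r' 6 = r 6 + k * r 3 \<and> (\<forall>i. i \<noteq> 6 \<and> i \<noteq> 7 \<longrightarrow> r' i = r i)) (r, m)"
  using assms
proof (induction k arbitrary: r)
  case 0
  then show ?case unfolding mult_loop_def by (subst wp_While) simp
next
  case (Suc k)
  have IH: "wp mult_loop (\<lambda>t (r', m'). t \<le> 3 * k + 1 \<and> m' = m \<and>
      r' 6 = q 6 + k * q 3 \<and> (\<forall>i. i \<noteq> 6 \<and> i \<noteq> 7 \<longrightarrow> r' i = q i)) (q, m)"
    if "q 7 = k" "q 9 = 1" for q
    using that by (rule Suc.IH)
  show ?case
    using Suc.prems
    apply (subst mult_loop_def, subst wp_While, fold mult_loop_def)
    apply simp
    apply (rule wp_mono[OF IH])
    apply auto
    done
qed

definition power_loop :: com where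
  "power_loop =
     WhileNonzero 5 (SetConst 6 0 ;; Copy 7 1 ;; mult_loop ;; Copy 3 6 ;; Sub 5 5 9)"

text \<open>A round costs at most \<open>3 * r 1 + 1\<close> steps for the product, four for the
  other commands and one for the test.\<close>

lemma power_loop:
  assumes "r 5 = k" "r 9 = 1"
  shows "wp power_loop (\<lambda>t (r', m'). t \<le> k * (3 * r 1 + 6) + 1 \<and> m' = m \<and>
      r' 3 = r 1 ^ k * r 3 \<and>
      (\<forall>i. i \<noteq> 3 \<and> i \<noteq> 5 \<and> i \<noteq> 6 \<and> i \<noteq> 7 \<longrightarrow> r' i = r i)) (r, m)"
  using assms
proof (induction k arbitrary: r)
  case 0
  then show ?case unfolding power_loop_def by (subst wp_While) simp
next
  case (Suc k)
  let ?Q = "\<lambda>q t (r', m'). t \<le> k * (3 * q 1 + 6) + 1 \<and> m' = m \<and> r' 3 = q 1 ^ k * q 3 \<and>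
      (\<forall>i. i \<noteq> 3 \<and> i \<noteq> 5 \<and> i \<noteq> 6 \<and> i \<noteq> 7 \<longrightarrow> r' i = q i)"
  have IH: "wp power_loop (?Q q) (q, m)" if "q 5 = k" "q 9 = 1" for q
    using that by (rule Suc.IH)
  have mult: "wp mult_loop (\<lambda>t (r', m'). t \<le> 3 * r 1 + 1 \<and> m' = m \<and>
      r' 6 = r 1 * r 3 \<and> (\<forall>i. i \<noteq> 6 \<and> i \<noteq> 7 \<longrightarrow> r' i = r i)) (r(6 := 0, 7 := r 1), m)"
    using mult_loop[of "r(6 := 0, 7 := r 1)" "r 1" m] Suc.prems by (auto elim!: wp_mono)
  show ?case
    using Suc.prems mult
    apply (subst power_loop_def, subst wp_While, fold power_loop_def)
    apply simp
    apply (erule wp_mono)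
    apply clarsimp
    apply (rule wp_mono[OF IH])
    apply (auto simp: algebra_simps)
    done
qed

text \<open>The machine tests only for nonzero values. Register 7 keeps
  \<open>r 4 + 1 - r 1\<close>, which under truncated subtraction is nonzero exactly when the
  divisor can be subtracted once more.\<close>

definition div_loop :: com where
  "div_loop = WhileNonzero 7 (Sub 4 4 1 ;; Add 6 6 9 ;; Sub 7 7 1)"

lemma div_loop:
  assumes "0 < r 1" "r 9 = 1" "r 7 = r 4 + 1 - r 1"
  shows "wp div_loop (\<lambda>t (r', m'). t \<le> 4 * r 4 + 1 \<and> m' = m \<and>
      r' 4 = r 4 mod r 1 \<and> r' 6 = r 6 + r 4 div r 1 \<and>
      (\<forall>i. i \<noteq> 4 \<and> i \<noteq> 6 \<and> i \<noteq> 7 \<longrightarrow> r' i = r i)) (r, m)"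
  using assms
proof (induction "r 4" arbitrary: r rule: less_induct)
  case less
  show ?case
  proof (cases "r 4 < r 1")
    case True
    then show ?thesis using less.prems unfolding div_loop_def by (subst wp_While) simp
  next
    case False
    have IH: "wp div_loop (\<lambda>t (r', m'). t \<le> 4 * q 4 + 1 \<and> m' = m \<and>
        r' 4 = q 4 mod q 1 \<and> r' 6 = q 6 + q 4 div q 1 \<and>
        (\<forall>i. i \<noteq> 4 \<and> i \<noteq> 6 \<and> i \<noteq> 7 \<longrightarrow> r' i = q i)) (q, m)"
      if "q 4 = r 4 - r 1" "q 1 = r 1" "q 9 = 1" "q 7 = q 4 + 1 - q 1" for q
      using that less.prems False by (intro less.hyps) auto
    show ?thesis
      using less.prems False
      apply (subst div_loop_def, subst wp_While, fold div_loop_def)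
      apply simp
      apply (rule wp_mono[OF IH])
      apply (auto simp: le_mod_geq le_div_geq)
      done
  qed
qed

section \<open>Decoding a candidate\<close>

text \<open>Order and multiplicity of the digits do not matter, and leading zeros contribute
  nothing. The guard on \<open>B\<close> makes \<open>v div B\<close> smaller than
  \<open>v\<close>.\<close>

function digit_set :: "nat \<Rightarrow> nat \<Rightarrow> nat set" where
  "digit_set B v =
     (if v = 0 \<or> B < 2 then {} else insert (v mod B) (digit_set B (v div B)))"
  by pat_completeness auto
termination
  by (relation "measure snd") auto

declare digit_set.simps [simp del]

text \<open>Each digit is an input position. The value \<open>x\<close> found there is marked by
  writing the candidate itself at address \<open>N + x\<close>, beyond the input.\<close>

definition decode_loop :: com where
  "decode_loop =
     WhileNonzero 4 (SetConst 6 0 ;; Add 7 4 9 ;; Sub 7 7 1 ;; div_loop ;;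
       Load 8 4 ;; Add 8 1 8 ;; Store 8 3 ;; Copy 4 6)"

lemma decode_loop:
  assumes "2 \<le> length w" "r 1 = length w" "r 9 = 1" "holds m 0 w"
  shows "wp decode_loop (\<lambda>t (r', m'). t \<le> r 4 * (4 * r 4 + 9) + 1 \<and> holds m' 0 w \<and>
      (\<forall>x. m' (length w + x) =
        (if x \<in> (!) w ` digit_set (length w) (r 4) then r 3 else m (length w + x))) \<and>
      (\<forall>i. i \<noteq> 4 \<and> i \<noteq> 6 \<and> i \<noteq> 7 \<and> i \<noteq> 8 \<longrightarrow> r' i = r i)) (r, m)"
  using assms
proof (induction "r 4" arbitrary: r m rule: less_induct)
  case less
  let ?N = "length w"
  show ?case
  proof (cases "r 4 = 0")
    case True
    then show ?thesis
      using less.prems unfolding decode_loop_def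
      by (subst wp_While) (simp add: digit_set.simps)
  next
    case False
    define q where "q = r(6 := 0, 7 := r 4 + 1 - ?N)"
    have digits: "digit_set ?N (r 4) = insert (r 4 mod ?N) (digit_set ?N (r 4 div ?N))"
      using False less.prems by (subst digit_set.simps) simp
    have "0 < ?N" using less.prems by linarith
    then have mod: "r 4 mod ?N < ?N" by simp
    have smaller: "r 4 div ?N < r 4" using False less.prems by simp
    have div: "wp div_loop (\<lambda>t (r', m'). t \<le> 4 * r 4 + 1 \<and> m' = m \<and>
        r' 4 = r 4 mod ?N \<and> r' 6 = r 4 div ?N \<and>
        (\<forall>i. i \<noteq> 4 \<and> i \<noteq> 6 \<and> i \<noteq> 7 \<longrightarrow> r' i = r i)) (q, m)"
      using div_loop[of q m] less.prems \<open>0 < ?N\<close> by (auto simp: q_def elim!: wp_mono)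
    let ?Q = "\<lambda>q n t (r', m'). t \<le> q 4 * (4 * q 4 + 9) + 1 \<and> holds m' 0 w \<and>
      (\<forall>x. m' (?N + x) =
        (if x \<in> (!) w ` digit_set ?N (q 4) then q 3 else n (?N + x))) \<and>
      (\<forall>i. i \<noteq> 4 \<and> i \<noteq> 6 \<and> i \<noteq> 7 \<and> i \<noteq> 8 \<longrightarrow> r' i = q i)"
    have IH: "wp decode_loop (?Q q n) (q, n)"
      if "q 4 = r 4 div ?N" "q 1 = ?N" "q 9 = 1" "holds n 0 w" for q n
      using that smaller less.prems by (intro less.hyps) auto
    have m: "m (r 4 mod ?N) = w ! (r 4 mod ?N)"
      using less.prems(4) mod by (simp add: holds_def)
    \<comment> \<open>A round costs at most \<open>4 * r 4 + 9\<close> steps and lowers register 4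
      by at least one, so one such charge per unit of \<open>r 4\<close> suffices.\<close>
    have "r 4 div ?N * (4 * (r 4 div ?N) + 9) \<le> (r 4 - 1) * (4 * r 4 + 9)"
      using smaller by (intro mult_le_mono) auto
    also have "(r 4 - 1) * (4 * r 4 + 9) + (4 * r 4 + 9) = r 4 * (4 * r 4 + 9)"
      using False by (cases "r 4") auto
    finally have time: "r 4 div ?N * (4 * (r 4 div ?N) + 9) + (4 * r 4 + 9) \<le> r 4 * (4 * r 4 + 9)"
      by simp
    from div show ?thesis
      using False
      apply (subst decode_loop_def, subst wp_While, fold decode_loop_def)
      apply (simp add: q_def less.prems)
      apply (erule wp_mono)
      apply clarsimp
      apply (rule wp_mono[OF IH])
      using less.prems m time
      apply (auto simp: digits holds_def)
      done
  qed
qed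

section \<open>Checking a candidate\<close>

text \<open>Mark and candidate agree exactly when the sum of their two truncated differences is
  zero. Only the variable cell of a literal is read, which decides its truth when the formula is
  monotone.\<close>

definition count_loop :: com where
  "count_loop =
     WhileNonzero 7 (Add 10 4 9 ;; Load 10 10 ;; Add 10 1 10 ;; Load 10 10 ;;
       Sub 11 10 3 ;; Sub 10 3 10 ;; Add 10 10 11 ;; IfNonzero 10 (SetConst 10 0) (Add 8 8 9) ;;
       Add 4 4 9 ;; Add 4 4 9 ;; Sub 7 7 9)"

lemma count_loop:
  assumes "holds m (r 4) (concat (map encode_lit C))" "r 7 = length C" "r 9 = 1"
  shows "wp count_loop (\<lambda>t (r', m'). t \<le> 13 * length C + 1 \<and> m' = m \<and>
      r' 4 = r 4 + 2 * length C \<and>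
      r' 8 = r 8 + length (filter (\<lambda>L. m (r 1 + var_of L) = r 3) C) \<and>
      (\<forall>i. i \<noteq> 4 \<and> i \<noteq> 7 \<and> i \<noteq> 8 \<and> i \<noteq> 10 \<and> i \<noteq> 11 \<longrightarrow> r' i = r i)) (r, m)"
  using assms
proof (induction C arbitrary: r)
  case Nil
  then show ?case unfolding count_loop_def by (subst wp_While) simp
next
  case (Cons L C)
  let ?Q = "\<lambda>q t (r', m'). t \<le> 13 * length C + 1 \<and> m' = m \<and>
      r' 4 = q 4 + 2 * length C \<and>
      r' 8 = q 8 + length (filter (\<lambda>L. m (q 1 + var_of L) = q 3) C) \<and>
      (\<forall>i. i \<noteq> 4 \<and> i \<noteq> 7 \<and> i \<noteq> 8 \<and> i \<noteq> 10 \<and> i \<noteq> 11 \<longrightarrow> r' i = q i)"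
  have lit: "m (r 4 + 1) = var_of L" "holds m (r 4 + 2) (concat (map encode_lit C))"
    using Cons.prems(1) by (cases L; simp add: add.assoc)+
  have IH: "wp count_loop (?Q q) (q, m)"
    if "q 4 = r 4 + 2" "q 7 = length C" "q 9 = 1" for q
    using that lit by (intro Cons.IH) auto
  show ?case
    using Cons.prems lit
    apply (subst count_loop_def, subst wp_While, fold count_loop_def)
    apply simp
    apply (intro conjI impI)
    subgoal by (rule wp_mono[OF IH]) (auto simp: add.assoc)
    subgoal by (rule wp_mono[OF IH]) (auto simp: add.assoc)
    done
qed

text \<open>Register 5 accumulates the distances of the counts from 1, so it stays zero exactly when
  every clause contains one marked literal.\<close>

definition check_loop :: com where
  "check_loop =
     WhileNonzero 6 (Load 7 4 ;; Add 4 4 9 ;; SetConst 8 0 ;; count_loop ;;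
       Sub 10 8 9 ;; Sub 11 9 8 ;; Add 5 5 10 ;; Add 5 5 11 ;; Sub 6 6 9)"

text \<open>A clause of \<open>k\<close> literals costs at most \<open>13 * k + 10\<close> steps and
  occupies \<open>1 + 2 * k\<close> cells; thirteen steps per cell are enough.\<close>

lemma check_loop:
  assumes "holds m (r 4) (concat (map encode_clause Cs))" "r 6 = length Cs" "r 9 = 1"
  shows "wp check_loop (\<lambda>t (r', m'). t \<le> 13 * length (concat (map encode_clause Cs)) + 1 \<and> m' = m \<and>
      (r' 5 = 0 \<longleftrightarrow> r 5 = 0 \<and>
        (\<forall>C\<in>set Cs. length (filter (\<lambda>L. m (r 1 + var_of L) = r 3) C) = 1)) \<and>
      (\<forall>i. i < 4 \<or> i = 9 \<longrightarrow> r' i = r i)) (r, m)"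
  using assms
proof (induction Cs arbitrary: r)
  case Nil
  then show ?case unfolding check_loop_def by (subst wp_While) simp
next
  case (Cons C Cs)
  let ?Q = "\<lambda>q t (r', m'). t \<le> 13 * length (concat (map encode_clause Cs)) + 1 \<and> m' = m \<and>
      (r' 5 = 0 \<longleftrightarrow> q 5 = 0 \<and>
        (\<forall>C\<in>set Cs. length (filter (\<lambda>L. m (q 1 + var_of L) = q 3) C) = 1)) \<and>
      (\<forall>i. i < 4 \<or> i = 9 \<longrightarrow> r' i = q i)"
  let ?n = "length (filter (\<lambda>L. m (r 1 + var_of L) = r 3) C)"
  have IH: "wp check_loop (?Q q) (q, m)"
    if "q 4 = r 4 + 1 + 2 * length C" "q 6 = length Cs" "q 9 = 1" for q
    using that Cons.prems by (intro Cons.IH) (auto simp: encode_clause_def)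
  have "wp count_loop (\<lambda>t (r', m'). t \<le> 13 * length C + 1 \<and> m' = m \<and>
      r' 4 = r 4 + 1 + 2 * length C \<and> r' 8 = ?n \<and>
      (\<forall>i. i \<noteq> 4 \<and> i \<noteq> 7 \<and> i \<noteq> 8 \<and> i \<noteq> 10 \<and> i \<noteq> 11 \<longrightarrow> r' i = r i))
      (r(7 := length C, 4 := r 4 + 1, 8 := 0), m)"
    using count_loop[of m "r(7 := length C, 4 := r 4 + 1, 8 := 0)" C] Cons.prems
    by (auto simp: encode_clause_def elim!: wp_mono)
  from this Cons.prems show ?case
    apply (subst check_loop_def, subst wp_While, fold check_loop_def)
    apply (simp add: encode_clause_def)
    apply (erule wp_mono)
    apply clarsimp
    apply (rule wp_mono[OF IH])
    apply (auto simp: encode_clause_def)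
    done
qed

section \<open>Exhaustive search\<close>

text \<open>The test of a candidate without reference to the machine: the interface between the
  program and \<open>x_sat\<close>.\<close>

definition passes :: "lit list list \<Rightarrow> nat \<Rightarrow> bool" where
  "passes Cs v \<longleftrightarrow> (let w = encode_formula Cs in
     \<forall>C\<in>set Cs. length (filter (\<lambda>L. var_of L \<in> (!) w ` digit_set (length w) v) C) = 1)"

text \<open>Clearing the temporary register 5 serves as an idle command when the candidate
  fails.\<close>

definition search_loop :: com where
  "search_loop =
     WhileNonzero 3 (Copy 4 3 ;; decode_loop ;; SetConst 4 1 ;; SetConst 5 0 ;; Copy 6 2 ;;
       check_loop ;; IfNonzero 5 (SetConst 5 0) (SetConst 0 1) ;; Sub 3 3 9)"

text \<open>Since the candidates decrease, old marks exceed the current candidate and need not be erased.\<close>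

lemma search_loop:
  assumes "w = encode_formula Cs" "2 \<le> length w"
    and "r 1 = length w" "r 2 = length Cs" "r 3 = k" "r 9 = 1" "k \<le> K"
    and "holds m 0 w" "\<forall>x. m (length w + x) = 0 \<or> k < m (length w + x)"
  shows "wp search_loop (\<lambda>t (r', m').
      t \<le> k * (K * (4 * K + 9) + 13 * length w + 13) + 1 \<and>
      r' 0 = (if \<exists>v\<in>{1..k}. passes Cs v then 1 else r 0)) (r, m)"
  using assms(3-)
proof (induction k arbitrary: r m)
  case 0
  then show ?case unfolding search_loop_def by (subst wp_While) simp
next
  case (Suc k)
  let ?N = "length w"
  let ?T = "(!) w ` digit_set ?N (Suc k)"
  have w: "w = length Cs # concat (map encode_clause Cs)"
    by (simp add: assms(1) encode_formula_def)
  \<comment> \<open>Charging every candidate as if it were the largest one, \<open>K\<close>, gives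
    all rounds the same bound.\<close>
  have "Suc k * (4 * Suc k + 9) \<le> K * (4 * K + 9)"
    using Suc.prems by (intro mult_le_mono) auto
  then have decode: "wp decode_loop (\<lambda>t (r', m'). t \<le> K * (4 * K + 9) + 1 \<and> holds m' 0 w \<and>
      (\<forall>x. m' (?N + x) = (if x \<in> ?T then Suc k else m (?N + x))) \<and>
      (\<forall>i. i \<noteq> 4 \<and> i \<noteq> 6 \<and> i \<noteq> 7 \<and> i \<noteq> 8 \<longrightarrow> r' i = r i)) (r(4 := Suc k), m)"
    using Suc.prems assms(2)
    by (intro wp_mono[OF decode_loop[of w]]) auto
  have check: "wp check_loop (\<lambda>t (r', m'). t \<le> 13 * ?N + 1 \<and> m' = n \<and>
      (r' 5 = 0 \<longleftrightarrow> passes Cs (Suc k)) \<and> (\<forall>i. i < 4 \<or> i = 9 \<longrightarrow> r' i = r i)) (q, n)"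
    if n: "holds n 0 w" "\<forall>x. n (?N + x) = (if x \<in> ?T then Suc k else m (?N + x))"
      and q: "q 4 = 1" "q 5 = 0" "q 6 = length Cs" "\<forall>i. i < 4 \<or> i = 9 \<longrightarrow> q i = r i" for q n
  proof -
    \<comment> \<open>A cell outside \<open>?T\<close> is zero or exceeds \<open>Suc k\<close>,
      hence differs from the current candidate.\<close>
    have "n (?N + x) = Suc k \<longleftrightarrow> x \<in> ?T" for x
      using n(2) Suc.prems(7)[rule_format, of x] by auto
    then have "passes Cs (Suc k) \<longleftrightarrow>
        (\<forall>C\<in>set Cs. length (filter (\<lambda>L. n (q 1 + var_of L) = q 3) C) = 1)"
      using q(4) Suc.prems by (simp add: passes_def Let_def flip: assms(1))
    then show ?thesis
      using n q Suc.prems w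
      by (intro wp_mono[OF check_loop[of n q Cs]]) auto
  qed
  let ?B = "K * (4 * K + 9) + 13 * ?N + 13"
  have IH: "wp search_loop (\<lambda>t (r', m'). t \<le> k * ?B + 1 \<and>
      r' 0 = (if \<exists>v\<in>{1..k}. passes Cs v then 1 else q 0)) (q, n)"
    if "holds n 0 w" "\<forall>x. n (?N + x) = (if x \<in> ?T then Suc k else m (?N + x))"
      "q 1 = r 1" "q 2 = r 2" "q 3 = k" "q 9 = 1" for q n
    using that Suc.prems by (intro Suc.IH) (auto dest: Suc_lessD)
  define verdict where "verdict = (if \<exists>v\<in>{1..Suc k}. passes Cs v then 1 else r 0)"
  have verdict: "verdict = (if \<exists>v\<in>{1..k}. passes Cs v then 1
      else if passes Cs (Suc k) then 1 else r 0)"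
    by (simp add: verdict_def atLeastAtMostSuc_conv)
  show ?case
    unfolding verdict_def[symmetric]
    using Suc.prems decode
    apply (subst search_loop_def, subst wp_While, fold search_loop_def)
    apply simp
    apply (erule wp_mono)
    apply clarsimp
    apply (rule wp_mono[OF check])
         apply assumption
        apply blast
       apply simp_all
    apply clarsimp
    apply (intro conjI impI)
    subgoal by (rule wp_mono[OF IH]) (auto simp: verdict)
    subgoal by (rule wp_mono[OF IH]) (auto simp: verdict)
    done
qed

text \<open>Register 0 is initially zero, so \<open>Load 2 0\<close> reads the clause count at
  address 0.\<close>

definition x_sat_solver :: com where
  "x_sat_solver =
     SetConst 9 1 ;; Load 2 0 ;; SetConst 1 1 ;; Copy 5 2 ;; parse_loop ;;
     SetConst 3 1 ;; Copy 5 2 ;; power_loop ;; search_loop"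

text \<open>Decoding takes time quadratic in the candidate, and there are
  \<open>N ^ length Cs\<close> candidates; hence the cube.\<close>

lemma x_sat_solver:
  fixes Cs
  defines "N \<equiv> length (encode_formula Cs)"
  assumes "2 \<le> N"
  shows "wp x_sat_solver (\<lambda>t s. t \<le> 64 * N\<^sup>2 * (N ^ length Cs) ^ 3 \<and>
      fst s 0 = (if \<exists>v\<in>{1..N ^ length Cs}. passes Cs v then 1 else 0))
    (initial_state (encode_formula Cs))"
proof -
  let ?w = "encode_formula Cs"
  define m where "m = (\<lambda>a. if a < N then ?w ! a else 0)"
  let ?n = "length Cs" and ?K = "N ^ length Cs"
  have init: "initial_state ?w = (\<lambda>_. 0, m)"
    by (simp add: initial_state_def N_def m_def)
  have w: "?w = length Cs # concat (map encode_clause Cs)"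
    by (simp add: encode_formula_def)
  have holds: "holds m 0 ?w"
    by (simp add: holds_def N_def m_def)
  then have "m 0 = ?n"
    by (simp add: w)
  have parse: "wp parse_loop (\<lambda>t (r', m'). t \<le> 6 * ?n + 1 \<and> m' = m \<and> r' 1 = N \<and>
      (\<forall>i. i \<noteq> 1 \<and> i \<noteq> 5 \<and> i \<noteq> 6 \<longrightarrow> r' i = r i)) (r, m)"
    if "r 1 = 1" "r 5 = ?n" "r 9 = 1" for r
    using that holds w by (intro wp_mono[OF parse_loop[of m r Cs]]) (auto simp: N_def)
  have power: "wp power_loop (\<lambda>t (r', m'). t \<le> ?n * (3 * N + 6) + 1 \<and> m' = m \<and> r' 3 = ?K \<and>
      (\<forall>i. i \<noteq> 3 \<and> i \<noteq> 5 \<and> i \<noteq> 6 \<and> i \<noteq> 7 \<longrightarrow> r' i = r i)) (r, m)"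
    if "r 1 = N" "r 3 = 1" "r 5 = ?n" "r 9 = 1" for r
    using that by (intro wp_mono[OF power_loop[of r ?n]]) auto
  have search: "wp search_loop (\<lambda>t (r', m').
      t \<le> ?K * (?K * (4 * ?K + 9) + 13 * N + 13) + 1 \<and>
      r' 0 = (if \<exists>v\<in>{1..?K}. passes Cs v then 1 else r 0)) (r, m)"
    if "r 1 = N" "r 2 = ?n" "r 3 = ?K" "r 9 = 1" for r
    using that holds assms unfolding N_def by (intro search_loop) (auto simp: m_def N_def)
  have length: "length xs \<le> length (concat (map encode_clause xs))" for xs
    by (induction xs) (auto simp: encode_clause_def)
  have "?n \<le> N"
    using length[of Cs] by (simp add: N_def w)
  have time: "4 + (6 * ?n + 1) + 2 + (?n * (3 * N + 6) + 1) +
      (?K * (?K * (4 * ?K + 9) + 13 * N + 13) + 1) \<le> 64 * N\<^sup>2 * ?K ^ 3"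
  proof -
    define K where "K = ?K"
    let ?X = "N * N * (K * K * K)"
    have K: "1 \<le> K" and N: "1 \<le> N" using assms(2) by (auto simp: K_def)
    \<comment> \<open>Factors 1 are padded in so that each monomial is compared with
      \<open>?X\<close> factor by factor. The coefficients below add up to 63.\<close>
    have "1 * 1 * (1 * 1 * 1) \<le> ?X" "?n * 1 * (1 * 1 * 1) \<le> ?X"
      "?n * N * (1 * 1 * 1) \<le> ?X" "1 * 1 * (K * K * K) \<le> ?X"
      "1 * 1 * (K * K * 1) \<le> ?X" "1 * N * (K * 1 * 1) \<le> ?X" "1 * 1 * (K * 1 * 1) \<le> ?X"
      by (intro mult_le_mono order_refl K N \<open>?n \<le> N\<close>)+
    then have "9 + 12 * ?n + 3 * (?n * N) + 4 * (K * K * K) + 9 * (K * K) + 13 * (N * K) + 13 * K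
        \<le> 64 * ?X"
      by linarith
    then show ?thesis
      unfolding K_def[symmetric] by (simp add: algebra_simps power2_eq_square power3_eq_cube)
  qed
  define verdict where "verdict = (if \<exists>v\<in>{1..?K}. passes Cs v then 1 else 0 :: nat)"
  show ?thesis
    unfolding x_sat_solver_def init verdict_def[symmetric]
    apply (simp add: \<open>m 0 = ?n\<close>)
    apply (rule wp_mono[OF parse])
       apply simp_all
    apply clarsimp
    apply (rule wp_mono[OF power])
        apply simp_all
    apply clarsimp
    apply (rule wp_mono[OF search])
        apply simp_all
    apply (use time in \<open>clarsimp simp: verdict_def\<close>)
    done
qed

declare One_nat_def [simp]

section \<open>Correctness of the search\<close>

text \<open>Horner's scheme. Zero digits are excluded because the expansion stops at zero and would
  lose them in leading places.\<close>

lemma digit_set_surj: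
  assumes "2 \<le> B" "\<forall>p\<in>set ps. 1 \<le> p \<and> p < B"
  shows "\<exists>v<B ^ length ps. digit_set B v = set ps \<and> (ps \<noteq> [] \<longrightarrow> 1 \<le> v)"
  using assms(2)
proof (induction ps)
  case Nil
  then show ?case by (auto simp: digit_set.simps)
next
  case (Cons p ps)
  then obtain v where v: "v < B ^ length ps" "digit_set B v = set ps" by auto
  let ?v = "p + B * v"
  have p: "1 \<le> p" "p < B" using Cons.prems by auto
  then have "?v < B * (v + 1)" by (simp add: distrib_left)
  also have "\<dots> \<le> B * B ^ length ps" using v by (intro mult_le_mono) auto
  finally have "?v < B ^ length (p # ps)" by simp
  moreover have "digit_set B ?v = set (p # ps)"
    using p v assms(1) by (subst digit_set.simps) auto
  ultimately show ?case using p by (intro exI[of _ ?v]) auto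
qed

lemma var_in_encoding:
  assumes "C \<in> set Cs" "L \<in> set C"
  shows "\<exists>p. 1 \<le> p \<and> p < length (encode_formula Cs) \<and> encode_formula Cs ! p = var_of L"
proof -
  have "var_of L \<in> set (encode_lit L)" by (cases L) auto
  then have "var_of L \<in> set (concat (map encode_clause Cs))"
    using assms by (auto simp: encode_clause_def)
  then obtain i where "i < length (concat (map encode_clause Cs))"
    "concat (map encode_clause Cs) ! i = var_of L"
    by (metis in_set_conv_nth)
  then show ?thesis
    by (intro exI[of _ "Suc i"]) (auto simp: encode_formula_def)
qed

text \<open>Positions of the true variables, one per clause, are the digits of a passing candidate.
  Conversely the marked set is itself an assignment, even if some digits point to cells that hold no
  variable.\<close>

lemma x_sat_iff_passes:
  fixes Cs
  defines "N \<equiv> length (encode_formula Cs)"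
  assumes F: "lists_formula Cs F" "monotone_cnf F" and "Cs \<noteq> []" "2 \<le> N"
  shows "x_sat F \<longleftrightarrow> (\<exists>v\<in>{1..N ^ length Cs}. passes Cs v)"
proof -
  let ?w = "encode_formula Cs"
  have setF: "set ` set Cs = F" and dist: "\<And>C. C \<in> set Cs \<Longrightarrow> distinct C"
    using F(1) by (auto simp: lists_formula_def)
  have passes: "passes Cs v \<longleftrightarrow>
      (\<forall>C\<in>F. card {L\<in>C. var_of L \<in> (!) ?w ` digit_set N v} = 1)" for v
    unfolding passes_def Let_def setF[symmetric] N_def
    by (auto simp: dist distinct_length_filter Int_def conj_commute)
  have lit: "lit_true \<alpha> L \<longleftrightarrow> \<alpha> (var_of L)" if "C \<in> F" "L \<in> C" for \<alpha> C L
    using F(2) that by (force simp: monotone_cnf_def)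
  show ?thesis
  proof
    assume "x_sat F"
    then obtain \<alpha> where \<alpha>: "\<And>C. C \<in> F \<Longrightarrow> card {L\<in>C. lit_true \<alpha> L} = 1"
      by (auto simp: x_sat_def)
    have "\<exists>L. {L'\<in>C. lit_true \<alpha> L'} = {L}" if "C \<in> F" for C
      using \<alpha>[OF that] by (elim card_1_singletonE) blast
    then obtain g where g: "\<And>C. C \<in> F \<Longrightarrow> {L\<in>C. lit_true \<alpha> L} = {g C}"
      by metis
    have gC: "g (set C) \<in> set C" "lit_true \<alpha> (g (set C))" if "C \<in> set Cs" for C
      using g[of "set C"] that setF by auto
    have "\<exists>p. 1 \<le> p \<and> p < N \<and> ?w ! p = var_of (g (set C))" if "C \<in> set Cs" for C
      unfolding N_def using that gC(1)[OF that] by (rule var_in_encoding)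
    then obtain p where p: "\<And>C. C \<in> set Cs \<Longrightarrow> 1 \<le> p C \<and> p C < N \<and> ?w ! p C = var_of (g (set C))"
      by metis
    then have "\<forall>i\<in>set (map p Cs). 1 \<le> i \<and> i < N" by auto
    from digit_set_surj[OF \<open>2 \<le> N\<close> this] obtain v
      where v: "v < N ^ length Cs" "digit_set N v = p ` set Cs" "1 \<le> v"
      using \<open>Cs \<noteq> []\<close> by auto
    have T: "(!) ?w ` digit_set N v = var_of ` g ` F"
      unfolding v(2) setF[symmetric] image_image using p by (intro image_cong) auto
    \<comment> \<open>A chosen variable is true because some \<open>g D\<close> is a true positive
      literal; a true literal of \<open>C\<close> can only be \<open>g C\<close>.\<close>
    have "{L\<in>C. var_of L \<in> (!) ?w ` digit_set N v} = {L\<in>C. lit_true \<alpha> L}" if C: "C \<in> F" for C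
    proof -
      have "lit_true \<alpha> L" if L: "L \<in> C" "var_of L = var_of (g D)" "D \<in> F" for L D
      proof -
        have "g D \<in> D" "lit_true \<alpha> (g D)" using g[OF L(3)] by auto
        then show ?thesis using lit[OF C L(1)] lit[OF L(3)] L(2) by metis
      qed
      moreover have "var_of L \<in> var_of ` g ` F" if "L \<in> C" "lit_true \<alpha> L" for L
        using g[OF C] that C by blast
      ultimately show ?thesis
        unfolding T by (intro Collect_cong conj_cong refl) blast
    qed
    then have "passes Cs v" unfolding passes using \<alpha> by simp
    then show "\<exists>v\<in>{1..N ^ length Cs}. passes Cs v" using v by auto
  next
    assume "\<exists>v\<in>{1..N ^ length Cs}. passes Cs v"
    then obtain v where v: "passes Cs v" by blast
    let ?T = "(!) ?w ` digit_set N v"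
    have "{L\<in>C. lit_true (\<lambda>x. x \<in> ?T) L} = {L\<in>C. var_of L \<in> ?T}" if "C \<in> F" for C
      using lit[OF that, of _ "\<lambda>x. x \<in> ?T"] by (intro Collect_cong conj_cong refl) simp
    then show "x_sat F"
      using v unfolding passes x_sat_def by (intro exI[of _ "\<lambda>x. x \<in> ?T"]) simp
  qed
qed

section \<open>Counting clauses and variables\<close>

lemma finite_occurrences:
  "is_cnf F \<Longrightarrow> finite {(C, L). C \<in> F \<and> L \<in> C \<and> var_of L = x}"
  by (rule finite_subset[of _ "SIGMA C:F. C"]) (auto simp: is_cnf_def)

text \<open>The clauses through the variables of \<open>C\<close> cover \<open>F\<close>, including
  \<open>C\<close> since it is non-empty, and at most \<open>l\<close> of them pass through each
  variable.\<close>

lemma card_clauses_le: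
  assumes "is_cnf F" "exact_linear F" "regular_cnf l F" "C \<in> F"
  shows "card F \<le> l * card C"
proof -
  let ?D = "\<lambda>x. {D\<in>F. x \<in> clause_vars D}"
  have fin: "finite F" "finite C" "C \<noteq> {}" using assms by (auto simp: is_cnf_def)
  have "\<exists>x\<in>clause_vars C. x \<in> clause_vars D" if "D \<in> F" for D
  proof (cases "D = C")
    case True
    then show ?thesis using fin by (auto simp: clause_vars_def)
  next
    case False
    then have "card (clause_vars C \<inter> clause_vars D) = 1"
      using assms that by (auto simp: exact_linear_def)
    then have "clause_vars C \<inter> clause_vars D \<noteq> {}" by auto
    then show ?thesis by auto
  qed
  then have "F = (\<Union>x\<in>clause_vars C. ?D x)" by blast
  then have "card F = card (\<Union>x\<in>clause_vars C. ?D x)" by (rule arg_cong)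
  also have "\<dots> \<le> (\<Sum>x\<in>clause_vars C. card (?D x))"
    using fin by (intro card_UN_le) (simp add: clause_vars_def)
  also have "\<dots> \<le> (\<Sum>x\<in>clause_vars C. l)"
  proof (rule sum_mono)
    fix x assume "x \<in> clause_vars C"
    then have "occurrences F x = l"
      using assms by (auto simp: regular_cnf_def formula_vars_def)
    \<comment> \<open>Projecting occurrences to their clauses bounds the number of clauses through
      \<open>x\<close>.\<close>
    moreover have "?D x = fst ` {(D, L). D \<in> F \<and> L \<in> D \<and> var_of L = x}"
      by (force simp: clause_vars_def)
    ultimately show "card (?D x) \<le> l"
      using card_image_le[OF finite_occurrences[OF assms(1)], of fst x]
      by (simp add: occurrences_def)
  qed
  also have "\<dots> \<le> l * card C"
    using fin card_image_le[of C var_of] by (simp add: clause_vars_def)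
  finally show ?thesis .
qed

text \<open>Double counting of literal occurrences, by clause and by variable.\<close>

lemma formula_size_regular:
  assumes "is_cnf F" "regular_cnf l F"
  shows "formula_size F = l * card (formula_vars F)"
proof -
  let ?S = "SIGMA C:F. C"
  have fin: "finite F" "\<And>C. C \<in> F \<Longrightarrow> finite C" using assms by (auto simp: is_cnf_def)
  then have "finite ?S" "finite (formula_vars F)"
    by (auto simp: formula_vars_def clause_vars_def)
  have "formula_size F = (\<Sum>_\<in>?S. 1)"
    using fin by (simp add: formula_size_def)
  also have "\<dots> = (\<Sum>x\<in>formula_vars F. \<Sum>_\<in>{p\<in>?S. var_of (snd p) = x}. 1)"
    using \<open>finite ?S\<close> \<open>finite (formula_vars F)\<close>
    by (intro sum.group[symmetric]) (auto simp: formula_vars_def clause_vars_def)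
  also have "\<dots> = (\<Sum>x\<in>formula_vars F. l)"
  proof (rule sum.cong[OF refl])
    fix x assume "x \<in> formula_vars F"
    moreover have "{p\<in>?S. var_of (snd p) = x} = {(C, L). C \<in> F \<and> L \<in> C \<and> var_of L = x}"
      by auto
    ultimately show "(\<Sum>_\<in>{p\<in>?S. var_of (snd p) = x}. 1) = l"
      using assms by (simp add: regular_cnf_def occurrences_def)
  qed
  finally show ?thesis by simp
qed

lemma card_clauses_le_sqrt:
  assumes "is_cnf F" "exact_linear F" "regular_cnf l F"
  shows "real (card F) \<le> l * sqrt (card (formula_vars F))"
proof -
  have "card F * card F = (\<Sum>C\<in>F. card F)" by simp
  also have "\<dots> \<le> (\<Sum>C\<in>F. l * card C)"
    using card_clauses_le[OF assms] by (intro sum_mono) auto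
  also have "\<dots> = l * formula_size F"
    by (simp add: formula_size_def sum_distrib_left)
  also have "\<dots> = l * l * card (formula_vars F)"
    using formula_size_regular[OF assms(1,3)] by simp
  finally have "real (card F * card F) \<le> real (l * l * card (formula_vars F))"
    by (rule of_nat_mono)
  then have "(real (card F))\<^sup>2 \<le> (l * sqrt (card (formula_vars F)))\<^sup>2"
    by (simp add: power2_eq_square algebra_simps)
  then show ?thesis
    by (rule power2_le_imp_le) simp
qed

lemma card_clauses_le_size:
  assumes "is_cnf F"
  shows "card F \<le> formula_size F"
proof -
  have "(\<Sum>C\<in>F. 1) \<le> (\<Sum>C\<in>F. card C)"
    using assms by (intro sum_mono) (auto simp: is_cnf_def Suc_le_eq card_gt_0_iff)
  then show ?thesis by (simp add: formula_size_def)
qed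

lemma length_encode_formula:
  assumes "lists_formula Cs F"
  shows "length (encode_formula Cs) = 1 + card F + 2 * formula_size F" "length Cs = card F"
proof -
  have F: "distinct (map set Cs)" "F = set (map set Cs)" "\<And>C. C \<in> set Cs \<Longrightarrow> distinct C"
    using assms by (auto simp: lists_formula_def)
  show card: "length Cs = card F"
    using distinct_card[OF F(1)] F(2) by simp
  have "formula_size F = sum_list (map card (map set Cs))"
    unfolding formula_size_def F(2) using F(1) by (rule sum_list_distinct_conv_sum_set[symmetric])
  also have "map card (map set Cs) = map length Cs"
    using F(3) by (simp add: distinct_card)
  finally have size: "formula_size F = sum_list (map length Cs)" .
  have "length (concat (map encode_clause Cs)) = length Cs + 2 * sum_list (map length Cs)"
    for Cs by (induction Cs) (auto simp: encode_clause_def)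
  then show "length (encode_formula Cs) = 1 + card F + 2 * formula_size F"
    by (simp add: encode_formula_def size card)
qed

section \<open>From the clause count to the running time\<close>

text \<open>For \<open>n \<ge> 2\<close>, \<open>ln 2 \<le> ln n\<close> absorbs
  \<open>ln (4 * l)\<close> into a multiple of \<open>ln n\<close>. For \<open>n = 1\<close> the
  exponential is 1 and the factor \<open>(4 * l) ^ (3 * l)\<close> carries the bound.\<close>

lemma power_le_exp_ln_sqrt:
  fixes l n m :: nat
  assumes "0 < l" "0 < n" "real m \<le> l * sqrt n"
  shows "(4 * real l * real n) ^ (3 * m) \<le>
    (4 * real l) ^ (3 * l) * exp (3 * real l * (1 + ln (4 * real l) / ln 2) * ln n * sqrt n)"
proof (cases "n = 1")
  case True
  then have "m \<le> l" using assms by simp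
  then have "(4 * real l) ^ (3 * m) \<le> (4 * real l) ^ (3 * l)"
    using assms by (intro power_increasing) auto
  then show ?thesis using True by simp
next
  case False
  then have n: "2 \<le> n" using assms by simp
  let ?a = "ln (4 * real l)"
  have a: "0 \<le> ?a" using assms by simp
  have n2: "ln 2 \<le> ln (real n)" using n by simp
  have "?a * ln 2 \<le> ?a * ln (real n)" using a n2 by (intro mult_left_mono)
  then have "?a \<le> ?a / ln 2 * ln (real n)" by (simp add: field_simps)
  moreover have "ln (4 * real l * real n) = ?a + ln (real n)"
    using assms by (intro ln_mult_pos) auto
  ultimately have log: "ln (4 * real l * real n) \<le> (1 + ?a / ln 2) * ln (real n)"
    by (simp add: algebra_simps)
  \<comment> \<open>Makes the logarithm nonnegative, as monotonicity of the product
    requires.\<close>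
  have "1 * 1 \<le> (4 * real l) * real n" using assms by (intro mult_mono) auto
  then have "real (3 * m) * ln (4 * real l * real n) \<le>
      (3 * (l * sqrt n)) * ((1 + ?a / ln 2) * ln (real n))"
    using log assms a n n2 by (intro mult_mono) auto
  then have "exp (real (3 * m) * ln (4 * real l * real n)) \<le>
      exp (3 * real l * (1 + ?a / ln 2) * ln n * sqrt n)"
    by (simp add: mult_ac)
  moreover have "exp (real (3 * m) * ln (4 * real l * real n)) = (4 * real l * real n) ^ (3 * m)"
    using assms by (simp only: exp_of_nat_mult) simp
  moreover have "1 * exp (3 * real l * (1 + ?a / ln 2) * ln n * sqrt n) \<le>
      (4 * real l) ^ (3 * l) * exp (3 * real l * (1 + ?a / ln 2) * ln n * sqrt n)"
    using assms by (intro mult_right_mono one_le_power) auto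
  ultimately show ?thesis by linarith
qed

lemma solver_decides_x_sat:
  assumes "0 < l" "is_cnf F" "monotone_cnf F" "exact_linear F" "regular_cnf l F"
  shows "decides_x_sat_within x_sat_solver F
    (1024 * (4 * real l) ^ (3 * l) * (real (formula_size F))\<^sup>2 *
      exp (3 * real l * (1 + ln (4 * real l) / ln 2) * ln (card (formula_vars F)) * sqrt (card (formula_vars F))))"
  unfolding decides_x_sat_within_def
proof (intro allI impI)
  fix Cs assume Cs: "lists_formula Cs F"
  let ?N = "length (encode_formula Cs)" and ?m = "card F" and ?n = "card (formula_vars F)"
  let ?S = "formula_size F"
  have m: "0 < ?m" "?m \<le> ?S"
    using assms card_clauses_le_size by (auto simp: is_cnf_def card_gt_0_iff)
  \<comment> \<open>The length is \<open>1 + ?m + 2 * ?S\<close> with \<open>1 \<le> ?m\<close> and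
    \<open>?m \<le> ?S\<close>.\<close>
  then have N: "2 \<le> ?N" "?N \<le> 4 * ?S" and len: "length Cs = ?m"
    using length_encode_formula[OF Cs] by auto
  then have "Cs \<noteq> []" using m by auto
  have S: "?S = l * ?n" using assms formula_size_regular by blast
  have "0 < ?n" using S m by (cases ?n) auto
  have "\<exists>t s. exec x_sat_solver (initial_state (encode_formula Cs)) t s \<and>
      t \<le> 64 * ?N\<^sup>2 * (?N ^ ?m) ^ 3 \<and> fst s 0 = (if x_sat F then 1 else 0)"
    using x_sat_solver[OF N(1)] x_sat_iff_passes[OF Cs assms(3) \<open>Cs \<noteq> []\<close> N(1)]
    by (simp add: wp_def len)
  then obtain t s where ts: "exec x_sat_solver (initial_state (encode_formula Cs)) t s"
    "t \<le> 64 * ?N\<^sup>2 * (?N ^ ?m) ^ 3" "fst s 0 = (if x_sat F then 1 else 0)"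
    by blast
  have "t \<le> 64 * ?N\<^sup>2 * ?N ^ (3 * ?m)"
    using ts(2) by (simp add: power_mult[symmetric] mult.commute)
  also have "\<dots> \<le> 64 * (4 * ?S)\<^sup>2 * (4 * ?S) ^ (3 * ?m)"
    using N(2) by (intro mult_le_mono power_mono order_refl) auto
  finally have "real t \<le> real (64 * (4 * ?S)\<^sup>2 * (4 * ?S) ^ (3 * ?m))"
    by (rule of_nat_mono)
  \<comment> \<open>Here \<open>1024 = 64 * 4\<^sup>2\<close>, and \<open>?S = l * ?n\<close>
    rewrites the base of the large power.\<close>
  also have "\<dots> = 1024 * (real ?S)\<^sup>2 * (4 * real l * real ?n) ^ (3 * ?m)"
    by (simp add: S power_mult_distrib mult_ac)
  also have "\<dots> \<le> 1024 * (real ?S)\<^sup>2 * ((4 * real l) ^ (3 * l) *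
      exp (3 * real l * (1 + ln (4 * real l) / ln 2) * ln ?n * sqrt ?n))"
    using power_le_exp_ln_sqrt[OF assms(1) \<open>0 < ?n\<close> card_clauses_le_sqrt[OF assms(2,4,5)]]
    by (intro mult_left_mono) auto
  finally show "\<exists>t s. exec x_sat_solver (initial_state (encode_formula Cs)) t s \<and>
      fst s 0 = (if x_sat F then 1 else 0) \<and>
      real t \<le> 1024 * (4 * real l) ^ (3 * l) * (real ?S)\<^sup>2 *
        exp (3 * real l * (1 + ln (4 * real l) / ln 2) * ln ?n * sqrt ?n)"
    using ts by (intro exI[of _ t] exI[of _ s]) (simp add: mult_ac)
qed

theorem theorem6:
  "\<exists>f :: nat \<Rightarrow> real. \<forall>l > 0. \<exists>(c :: com) (p :: real poly). \<forall>F.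
     is_cnf F \<and> monotone_cnf F \<and> exact_linear F \<and> regular_cnf l F \<longrightarrow>
     decides_x_sat_within c F
       (poly p (real (formula_size F)) *
        exp (f l * ln (real (card (formula_vars F))) * sqrt (real (card (formula_vars F)))))"
\<comment> \<open>The exponent factor comes from \<open>power_le_exp_ln_sqrt\<close>. One program
  serves every \<open>l\<close>; the factor depending on \<open>l\<close> goes into the coefficient
  of a quadratic monomial.\<close>
proof (rule exI[of _ "\<lambda>l. 3 * real l * (1 + ln (4 * real l) / ln 2)"], intro exI allI impI)
  fix l :: nat and F
  assume "0 < l" "is_cnf F \<and> monotone_cnf F \<and> exact_linear F \<and> regular_cnf l F"
  then show "decides_x_sat_within x_sat_solver F
      (poly (monom (1024 * (4 * real l) ^ (3 * l)) 2) (real (formula_size F)) *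
       exp (3 * real l * (1 + ln (4 * real l) / ln 2) *
         ln (real (card (formula_vars F))) * sqrt (real (card (formula_vars F)))))"
    using solver_decides_x_sat[of l F] by (simp add: poly_monom)
qed

end
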